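(* Let $X \in \Lambda^2_{14} = \mathfrak{g}_2$. Then there exist a $\mathrm{G}_2$-adapted frame $\mathcal{B} = \{ e_1, \ldots, e_7 \}$ and real numbers $\lambda \geq \mu \geq 0$ such that the matrix $[X]_{\mathcal{B}}$, whose $(i,j)$ entry is $X(e_i,e_j)$, is $$ [X]_{\mathcal{B}} = \begin{pmatrix} \begin{matrix} 0 & - \lambda & 0 \\ \lambda & 0 & 0 \\ 0 & 0 & 0 \end{matrix} & \\ & \begin{matrix} 0 & 0 & 0 & \lambda - \mu \\ 0 & 0 & - \mu & 0 \\ 0 & \mu & 0 & 0 \\ - (\lambda - \mu) & 0 & 0 & 0 \end{matrix} \end{pmatrix}, $$ where all nondisplayed entries are zero. Moreover, exactly three cases occur: (i) if $\lambda = \mu$, then $\lambda = \mu = 0$ and $X = 0$; (ii) if $\lambda > 0$ and $\mu = 0$, then $\operatorname{rank} X = 4$ and $\ker X$ is the associative $3$-plane spanned by $\{ e_3, e_5, e_6 \}$; (iii) if $\lambda > \mu > 0$, then $\operatorname{rank} X = 6$ and $\ker X$ is spanned by $e_3$.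
   Context: Equip $\mathbb{R}^7$ with its standard inner product $\langle \cdot,\cdot\rangle$, standard orientation and standard basis. Let $\varphi = e_{123} - e_{167} - e_{527} - e_{563} - e_{415} - e_{426} - e_{437}$ (where $e_{ijk} = e_i \wedge e_j \wedge e_k$ in the standard basis) and define the cross product $u \times v$ by $\langle u \times v, w \rangle = \varphi(u,v,w)$. A bilinear form $A$ on $\mathbb{R}^7$ is identified with the linear operator $A$ defined by $A(u,v) = \langle A(u), v \rangle$; thus $\Lambda^2 = \Lambda^2(\mathbb{R}^7)$ (skew-symmetric bilinear forms) is identified with $\mathfrak{so}(7)$. The subspace $\Lambda^2_{14} = \mathfrak{g}_2$ is the set of $X \in \Lambda^2$ with $X(v \times w) = X(v) \times w + v \times X(w)$ for all $v,w$ (the Lie algebra of $\mathrm{G}_2$, the stabilizer of $\varphi$ in $\mathrm{GL}(7,\mathbb{R})$). A $\mathrm{G}_2$-adapted frame is an oriented orthonormal basis $\{e_1,\dots,e_7\}$ of $\mathbb{R}^7$ with $e_3 = e_1 \times e_2$, $e_5 = e_1 \times e_4$, $e_6 = e_2 \times e_4$, $e_7 = e_3 \times e_4$. A $3$-dimensional subspace is associative if it is closed under the cross product. *)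

theory Defs
  imports "HOL-Analysis.Analysis"
begin

text \<open>R^7 is modelled as real^7.  The standard basis vector e_k (k = 1..7) is
  axis (of_nat k) 1; note that in the numeral type 7 the index of_nat 7 is 0,
  so of_nat is a bijection from {1..7} onto the index type.\<close>

definition cmp :: "real^7 \<Rightarrow> nat \<Rightarrow> real" where
  "cmp x k = x $ (of_nat k :: 7)"

text \<open>e_{ijk}(u,v,w) = det of the 3x3 matrix of the i,j,k components.\<close>
definition ewedge :: "nat \<Rightarrow> nat \<Rightarrow> nat \<Rightarrow> real^7 \<Rightarrow> real^7 \<Rightarrow> real^7 \<Rightarrow> real" where
  "ewedge i j k u v w =
     cmp u i * (cmp v j * cmp w k - cmp v k * cmp w j)
   - cmp u j * (cmp v i * cmp w k - cmp v k * cmp w i)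
   + cmp u k * (cmp v i * cmp w j - cmp v j * cmp w i)"

definition phi :: "real^7 \<Rightarrow> real^7 \<Rightarrow> real^7 \<Rightarrow> real" where
  "phi u v w = ewedge 1 2 3 u v w - ewedge 1 6 7 u v w - ewedge 5 2 7 u v w
     - ewedge 5 6 3 u v w - ewedge 4 1 5 u v w - ewedge 4 2 6 u v w - ewedge 4 3 7 u v w"

text \<open>Cross product: the unique vector with inner (u \<times> v) w = phi u v w.\<close>
definition cross7 :: "real^7 \<Rightarrow> real^7 \<Rightarrow> real^7" where
  "cross7 u v = (\<chi> i. phi u v (axis i 1))"

text \<open>Skew-symmetric bilinear forms, identified with operators A via A(u,v) = <A u, v>.\<close>
definition Lambda2 :: "(real^7 \<Rightarrow> real^7) set" where
  "Lambda2 = {A. linear A \<and> (\<forall>u v. A u \<bullet> v = - (A v \<bullet> u))}"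

definition g2 :: "(real^7 \<Rightarrow> real^7) set" where
  "g2 = {X \<in> Lambda2. \<forall>v w. X (cross7 v w) = cross7 (X v) w + cross7 v (X w)}"

definition frame_matrix :: "(nat \<Rightarrow> real^7) \<Rightarrow> real^7^7" where
  "frame_matrix e = (\<chi> r c. \<Sum>k\<in>{1..7}. if (of_nat k :: 7) = r then e k $ c else 0)"

definition oriented_orthonormal :: "(nat \<Rightarrow> real^7) \<Rightarrow> bool" where
  "oriented_orthonormal e \<longleftrightarrow>
     (\<forall>i\<in>{1..7}. \<forall>j\<in>{1..7}. e i \<bullet> e j = (if i = j then 1 else 0))
     \<and> det (frame_matrix e) > 0"

definition G2_adapted :: "(nat \<Rightarrow> real^7) \<Rightarrow> bool" where
  "G2_adapted e \<longleftrightarrow> oriented_orthonormal e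
     \<and> e 3 = cross7 (e 1) (e 2) \<and> e 5 = cross7 (e 1) (e 4)
     \<and> e 6 = cross7 (e 2) (e 4) \<and> e 7 = cross7 (e 3) (e 4)"

definition associative :: "(real^7) set \<Rightarrow> bool" where
  "associative S \<longleftrightarrow> subspace S \<and> dim S = 3 \<and> (\<forall>u\<in>S. \<forall>v\<in>S. cross7 u v \<in> S)"

definition normal_form :: "real \<Rightarrow> real \<Rightarrow> nat \<Rightarrow> nat \<Rightarrow> real" where
  "normal_form l m i j =
    (if (i, j) = (1, 2) then - l
     else if (i, j) = (2, 1) then l
     else if (i, j) = (4, 7) then l - m
     else if (i, j) = (5, 6) then - m
     else if (i, j) = (6, 5) then m
     else if (i, j) = (7, 4) then - (l - m)
     else 0)"

end

theory Submission
  imports Defs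
begin

text \<open>
  Since \<open>X\<close> is skew in odd dimension, it kills a unit vector \<open>n\<close>. As \<open>X\<close> is a derivation of the cross
  product, it commutes with \<open>J = n \<times> _\<close>, so \<open>S v = n \<times> X v\<close> is symmetric, and an eigenvector \<open>v\<close> of \<open>S\<close>
  orthogonal to \<open>n\<close> spans together with \<open>J v\<close> an \<open>X\<close>-invariant plane. Replacing \<open>n\<close> by \<open>- n\<close> if
  necessary, the eigenvalue of \<open>S\<close> on the orthogonal complement of \<open>n\<close> with the largest absolute
  value is some \<open>\<lambda> \<ge> 0\<close>; let \<open>e\<^sub>1\<close> be an eigenvector for it, \<open>e\<^sub>3 = n\<close> and \<open>e\<^sub>2 = J e\<^sub>1\<close>. Let \<open>e\<^sub>4\<close>
  be an eigenvector for the least eigenvalue \<open>\<mu> - \<lambda>\<close> of \<open>S\<close> on the complement of \<open>e\<^sub>1, e\<^sub>2, e\<^sub>3\<close>. The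
  derivation property then determines \<open>X\<close> on the whole adapted frame generated by \<open>e\<^sub>1, e\<^sub>2, e\<^sub>4\<close>, and
  the two extremal choices give \<open>0 \<le> 2 \<mu> \<le> \<lambda>\<close>, which excludes \<open>\<lambda> = \<mu> > 0\<close>.

  The frame generated by a triple \<open>(u, v, w)\<close> is positively oriented: its determinant never vanishes,
  so it keeps its sign while one vector of the triple moves along a segment, any two triples can be
  joined by such moves, and the standard triple has determinant 1.
\<close>

subsection \<open>The cross product\<close>

lemma exhaust_7:
  fixes x :: 7
  shows "x = 1 \<or> x = 2 \<or> x = 3 \<or> x = 4 \<or> x = 5 \<or> x = 6 \<or> x = 7"
proof (induct x)
  case (of_int z)
  then have "z = 0 \<or> z = 1 \<or> z = 2 \<or> z = 3 \<or> z = 4 \<or> z = 5 \<or> z = 6" by fastforce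
  then show ?case by auto
qed

lemma UNIV_7: "(UNIV::7 set) = {1,2,3,4,5,6,7}"
  using exhaust_7 by blast

lemma sum_7: "sum f (UNIV::7 set) = f 1 + f 2 + f 3 + f 4 + f 5 + f 6 + f 7"
  unfolding UNIV_7 by (simp add: ac_simps)

lemma forall_7: "(\<forall>i::7. P i) \<longleftrightarrow> P 1 \<and> P 2 \<and> P 3 \<and> P 4 \<and> P 5 \<and> P 6 \<and> P 7"
proof -
  have "(\<forall>i::7. P i) \<longleftrightarrow> (\<forall>i\<in>UNIV. P i)" by simp
  then show ?thesis unfolding UNIV_7 by simp
qed

lemma inner_7: "(u::real^7) \<bullet> v = u$1 * v$1 + u$2 * v$2 + u$3 * v$3 + u$4 * v$4 + u$5 * v$5 + u$6 * v$6 + u$7 * v$7"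
  by (simp add: inner_vec_def sum_7)

text \<open>Polynomial identities for the product are checked coordinatewise through these
  formulas.\<close>

lemma cross7_nth:
  "cross7 u v $ 1 = u$2 * v$3 - u$3 * v$2 - u$6 * v$7 + u$7 * v$6 + u$4 * v$5 - u$5 * v$4"
  "cross7 u v $ 2 = u$3 * v$1 - u$1 * v$3 + u$5 * v$7 - u$7 * v$5 + u$4 * v$6 - u$6 * v$4"
  "cross7 u v $ 3 = u$1 * v$2 - u$2 * v$1 - u$5 * v$6 + u$6 * v$5 + u$4 * v$7 - u$7 * v$4"
  "cross7 u v $ 4 = u$5 * v$1 - u$1 * v$5 + u$6 * v$2 - u$2 * v$6 + u$7 * v$3 - u$3 * v$7"
  "cross7 u v $ 5 = u$1 * v$4 - u$4 * v$1 + u$7 * v$2 - u$2 * v$7 - u$6 * v$3 + u$3 * v$6"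
  "cross7 u v $ 6 = u$1 * v$7 - u$7 * v$1 + u$2 * v$4 - u$4 * v$2 - u$3 * v$5 + u$5 * v$3"
  "cross7 u v $ 7 = u$6 * v$1 - u$1 * v$6 + u$2 * v$5 - u$5 * v$2 + u$3 * v$4 - u$4 * v$3"
  by (simp_all add: cross7_def phi_def ewedge_def cmp_def axis_def)

lemma bilinear_cross7: "bilinear cross7"
  unfolding bilinear_def linear_iff
  by (auto simp: vec_eq_iff forall_7 cross7_nth) (simp_all add: algebra_simps)

lemma cross7_skew: "cross7 u v = - cross7 v u"
  by (simp add: vec_eq_iff forall_7 cross7_nth)

lemma inner_cross7_rotate: "cross7 u v \<bullet> w = cross7 v w \<bullet> u"
  by (simp add: inner_7 cross7_nth algebra_simps)

text \<open>This is the polarization of \<open>cross7_cross7_self\<close> in its repeated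
  argument.\<close>

lemma cross7_cross7:
  "cross7 u (cross7 v w) + cross7 v (cross7 u w) = (u \<bullet> w) *\<^sub>R v + (v \<bullet> w) *\<^sub>R u - (2 * (u \<bullet> v)) *\<^sub>R w"
  unfolding vec_eq_iff forall_7 inner_7 cross7_nth vector_add_component vector_minus_component
    vector_scaleR_component real_scaleR_def
  by (intro conjI; simp only: algebra_simps)

lemma cross7_self [simp]: "cross7 u u = 0"
  by (simp add: vec_eq_iff forall_7 cross7_nth)

text \<open>For a unit vector \<open>u\<close>, \<open>cross7 u\<close> is thus a complex structure
  on the orthogonal complement of \<open>u\<close>.\<close>

lemma cross7_cross7_self: "cross7 u (cross7 u w) = (u \<bullet> w) *\<^sub>R u - (u \<bullet> u) *\<^sub>R w"
  unfolding vec_eq_iff forall_7 inner_7 cross7_nth vector_add_component vector_minus_component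
    vector_scaleR_component real_scaleR_def
  by (intro conjI; simp only: algebra_simps)

lemma cross7_anticommute:
  assumes "u \<bullet> v = 0" "u \<bullet> w = 0" "v \<bullet> w = 0"
  shows "cross7 u (cross7 v w) = - cross7 v (cross7 u w)"
  using cross7_cross7 [of u v w] assms by (simp add: eq_neg_iff_add_eq_0)

lemmas cross7_linear =
  bilinear_ladd [OF bilinear_cross7] bilinear_radd [OF bilinear_cross7]
  bilinear_lmul [OF bilinear_cross7] bilinear_rmul [OF bilinear_cross7]
  bilinear_lneg [OF bilinear_cross7] bilinear_rneg [OF bilinear_cross7]
  bilinear_lzero [OF bilinear_cross7] bilinear_rzero [OF bilinear_cross7]

text \<open>\<open>cross7 u\<close> is skew-adjoint, so the left side reduces to
  \<open>cross7_cross7_self\<close>.\<close>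

lemma inner_cross7_cross7:
  "cross7 u v \<bullet> cross7 u w = (u \<bullet> u) * (v \<bullet> w) - (u \<bullet> v) * (u \<bullet> w)"
proof -
  have "cross7 u v \<bullet> cross7 u w = - (cross7 u (cross7 u w) \<bullet> v)"
    using inner_cross7_rotate [of u v "cross7 u w"] inner_cross7_rotate [of v "cross7 u w" u]
      cross7_skew [of "cross7 u w" u] by simp
  then show ?thesis
    by (simp add: cross7_cross7_self inner_diff_left inner_diff_right inner_commute)
qed

lemma inner_cross7_self [simp]:
  "cross7 u v \<bullet> u = 0" "cross7 u v \<bullet> v = 0" "u \<bullet> cross7 u v = 0" "v \<bullet> cross7 u v = 0"
  by (simp_all add: inner_7 cross7_nth algebra_simps)

section \<open>Frames generated by a triple\<close>

definition triple_frame :: "real^7 \<Rightarrow> real^7 \<Rightarrow> real^7 \<Rightarrow> nat \<Rightarrow> real^7" where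
  "triple_frame u v w k =
     [u, v, cross7 u v, w, cross7 u w, cross7 v w, cross7 (cross7 u v) w] ! (k - 1)"

lemma triple_frame_simps [simp]:
  "triple_frame u v w 1 = u"
  "triple_frame u v w (Suc 0) = u"
  "triple_frame u v w 2 = v"
  "triple_frame u v w 3 = cross7 u v"
  "triple_frame u v w 4 = w"
  "triple_frame u v w 5 = cross7 u w"
  "triple_frame u v w 6 = cross7 v w"
  "triple_frame u v w 7 = cross7 (cross7 u v) w"
  by (simp_all add: triple_frame_def)

text \<open>The last condition puts \<open>w\<close> orthogonal to the associative plane of
  \<open>u\<close> and \<open>v\<close>. Lengths are left free so that a vector can move along a
  segment without renormalization.\<close>

definition orthogonal_triple :: "real^7 \<Rightarrow> real^7 \<Rightarrow> real^7 \<Rightarrow> bool" where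
  "orthogonal_triple u v w \<longleftrightarrow> u \<noteq> 0 \<and> v \<noteq> 0 \<and> w \<noteq> 0 \<and>
     u \<bullet> v = 0 \<and> u \<bullet> w = 0 \<and> v \<bullet> w = 0 \<and> cross7 u v \<bullet> w = 0"

lemma atLeastAtMost_1_7: "{1..7::nat} = {1,2,3,4,5,6,7}"
  by auto

text \<open>Products with a common factor are handled by \<open>inner_cross7_cross7\<close>, the
  others by rotating the triple product. The list holds the squared lengths, which are
  multiplicative.\<close>

lemma triple_frame_inner:
  assumes "orthogonal_triple u v w" "i \<in> {1..7}" "j \<in> {1..7}"
  shows "triple_frame u v w i \<bullet> triple_frame u v w j =
    (if i = j then [u \<bullet> u, v \<bullet> v, (u \<bullet> u) * (v \<bullet> v), w \<bullet> w, (u \<bullet> u) * (w \<bullet> w),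
       (v \<bullet> v) * (w \<bullet> w), (u \<bullet> u) * (v \<bullet> v) * (w \<bullet> w)] ! (i - 1) else 0)"
proof -
  have o: "u \<bullet> v = 0" "u \<bullet> w = 0" "v \<bullet> w = 0" "cross7 u v \<bullet> w = 0"
    using assms by (auto simp: orthogonal_triple_def)
  have o': "v \<bullet> u = 0" "w \<bullet> u = 0" "w \<bullet> v = 0" "w \<bullet> cross7 u v = 0"
    using o by (simp_all add: inner_commute)
  \<comment> \<open>Variants of \<open>inner_cross7_cross7\<close> in which the common factor stands
    on the right in one or both products.\<close>
  have L: "cross7 a c \<bullet> cross7 b c = (c \<bullet> c) * (a \<bullet> b) - (c \<bullet> a) * (c \<bullet> b)"
       "cross7 a c \<bullet> cross7 c b = (c \<bullet> a) * (c \<bullet> b) - (c \<bullet> c) * (a \<bullet> b)"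
       "cross7 c a \<bullet> cross7 b c = (c \<bullet> a) * (c \<bullet> b) - (c \<bullet> c) * (a \<bullet> b)" for a b c
    using inner_cross7_cross7 [of c a b] by (simp_all add: cross7_skew [of a c] cross7_skew [of b c])
  have p: "cross7 v w \<bullet> u = 0" "cross7 u w \<bullet> v = 0"
    using o(4) inner_cross7_rotate [of u v w] inner_cross7_rotate [of v u w] cross7_skew [of v u]
    by simp_all
  have "cross7 (cross7 u v) w \<bullet> u = cross7 u (cross7 u v) \<bullet> w"
    by (simp add: inner_cross7_rotate [of u])
  then have q1: "cross7 (cross7 u v) w \<bullet> u = 0"
    using o by (simp add: cross7_cross7_self inner_diff_left)
  have "cross7 (cross7 u v) w \<bullet> v = - (cross7 v (cross7 v u) \<bullet> w)"
    by (simp add: inner_cross7_rotate [of v] cross7_skew [of u v] cross7_linear)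
  then have q2: "cross7 (cross7 u v) w \<bullet> v = 0"
    using o by (simp add: cross7_cross7_self inner_diff_left inner_commute)
  have pq: "u \<bullet> cross7 v w = 0" "v \<bullet> cross7 u w = 0"
     "u \<bullet> cross7 (cross7 u v) w = 0" "v \<bullet> cross7 (cross7 u v) w = 0"
    using p q1 q2 by (simp_all add: inner_commute)
  note facts = o o' L inner_cross7_cross7 p q1 q2 pq
  have "\<forall>i\<in>{1,2,3,4,5,6,7}. \<forall>j\<in>{1,2,3,4,5,6,7}. triple_frame u v w i \<bullet> triple_frame u v w j =
    (if i = j then [u \<bullet> u, v \<bullet> v, (u \<bullet> u) * (v \<bullet> v), w \<bullet> w, (u \<bullet> u) * (w \<bullet> w),
       (v \<bullet> v) * (w \<bullet> w), (u \<bullet> u) * (v \<bullet> v) * (w \<bullet> w)] ! (i - 1) else 0)"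
    by (simp add: facts)
  then show ?thesis
    using assms(2,3) unfolding atLeastAtMost_1_7 by blast
qed

subsection \<open>Orientation of adapted frames\<close>

lemma frame_matrix_row:
  assumes "k \<in> {1..7}"
  shows "frame_matrix e $ of_nat k = e k"
proof -
  have "\<forall>k\<in>{1,2,3,4,5,6,7}. frame_matrix e $ of_nat k = e k"
    by (simp add: frame_matrix_def atLeastAtMost_1_7 [simplified] vec_eq_iff)
  then show ?thesis using assms unfolding atLeastAtMost_1_7 by blast
qed

lemma frame_matrix_nth [simp]:
  "frame_matrix e $ 1 = e 1" "frame_matrix e $ 2 = e 2" "frame_matrix e $ 3 = e 3"
  "frame_matrix e $ 4 = e 4" "frame_matrix e $ 5 = e 5" "frame_matrix e $ 6 = e 6"
  "frame_matrix e $ 7 = e 7"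
  using frame_matrix_row [of 1 e] frame_matrix_row [of 2 e] frame_matrix_row [of 3 e]
    frame_matrix_row [of 4 e] frame_matrix_row [of 5 e] frame_matrix_row [of 6 e]
    frame_matrix_row [of 7 e] by simp_all

text \<open>\<open>A ** transpose A\<close> is the Gram matrix of the rows, here diagonal with
  nonzero diagonal entries.\<close>

lemma det_orthogonal_rows_nz:
  fixes A :: "real^'n^'n"
  assumes "\<And>i j. i \<noteq> j \<Longrightarrow> A $ i \<bullet> A $ j = 0" "\<And>i. A $ i \<noteq> 0"
  shows "det A \<noteq> 0"
proof -
  let ?D = "A ** transpose A"
  have D: "?D $ i $ j = A $ i \<bullet> A $ j" for i j
    by (simp add: matrix_matrix_mult_def transpose_def inner_vec_def)
  have "det ?D = (\<Prod>i\<in>UNIV. ?D $ i $ i)"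
    by (rule det_diagonal) (simp add: D assms(1))
  also have "\<dots> \<noteq> 0"
    using assms(2) by (simp add: D)
  finally show ?thesis by (auto simp: det_mul)
qed

lemma det_signed_permute_rows:
  fixes A B :: "real^'n^'n"
  assumes "p permutes UNIV" "\<And>i. B $ i = c i *\<^sub>R A $ p i"
  shows "det B = prod c UNIV * of_int (sign p) * det A"
proof -
  have "B = (\<chi> i. c i *s (\<chi> i. A $ p i) $ i)"
    using assms(2) by (simp add: vec_eq_iff scalar_mult_eq_scaleR)
  then show ?thesis
    using det_rows_mul [of c "\<lambda>i. A $ p i"] det_permute_rows [OF assms(1), of A] by simp
qed

definition triple_det :: "real^7 \<Rightarrow> real^7 \<Rightarrow> real^7 \<Rightarrow> real" where
  "triple_det u v w = det (frame_matrix (triple_frame u v w))"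

lemma triple_frame_nz:
  assumes "orthogonal_triple u v w" "i \<in> {1..7}"
  shows "triple_frame u v w i \<noteq> 0"
proof -
  have nz: "u \<noteq> 0" "v \<noteq> 0" "w \<noteq> 0" using assms(1) by (auto simp: orthogonal_triple_def)
  have "triple_frame u v w i \<bullet> triple_frame u v w i \<noteq> 0"
    using triple_frame_inner [OF assms(1) assms(2) assms(2)] assms(2) nz
    unfolding atLeastAtMost_1_7 by auto
  then show ?thesis by auto
qed

lemma triple_det_nz:
  assumes "orthogonal_triple u v w"
  shows "triple_det u v w \<noteq> 0"
  unfolding triple_det_def
proof (rule det_orthogonal_rows_nz)
  have k: "\<exists>k\<in>{1..7}. i = of_nat k" for i :: 7
  proof -
    have "\<forall>i::7. i \<in> of_nat ` {1..7}"
      unfolding forall_7 atLeastAtMost_1_7 by simp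
    then show ?thesis by blast
  qed
  show "frame_matrix (triple_frame u v w) $ i \<bullet> frame_matrix (triple_frame u v w) $ j = 0"
    if "i \<noteq> j" for i j
    using k [of i] k [of j] that triple_frame_inner [OF assms] by (auto simp: frame_matrix_row)
  show "frame_matrix (triple_frame u v w) $ i \<noteq> 0" for i
    using k [of i] triple_frame_nz [OF assms] by (auto simp: frame_matrix_row)
qed

text \<open>The triple product \<open>cross7 u v \<bullet> w\<close> is alternating, so its
  vanishing does not depend on the order of the vectors.\<close>

lemma orthogonal_triple_swap12:
  assumes "orthogonal_triple u v w" shows "orthogonal_triple v u w"
  using assms by (simp add: orthogonal_triple_def inner_commute [of v u] cross7_skew [of v u])

lemma orthogonal_triple_swap23:
  assumes "orthogonal_triple u v w" shows "orthogonal_triple u w v"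
  using assms inner_cross7_rotate [of w u v] cross7_skew [of u w]
  by (simp add: orthogonal_triple_def inner_commute [of w v])

lemma sign_transpose_compose:
  "a \<noteq> b \<Longrightarrow> c \<noteq> d \<Longrightarrow> sign (Transposition.transpose a b \<circ> Transposition.transpose c d) = 1"
  for a b c d :: "'n::finite"
  by (simp add: sign_compose permutation_swap_id sign_swap_id)

text \<open>Exchanging two vectors of the triple permutes the frame by two transpositions and flips two signs.\<close>

lemma triple_det_swap12:
  "triple_det v u w = triple_det u v w"
proof -
  let ?p = "Transposition.transpose 1 2 \<circ> Transposition.transpose 5 6 :: 7 \<Rightarrow> 7"
  let ?c = "\<lambda>i::7. if i = 3 \<or> i = 7 then - 1 else 1 :: real"
  have "det (frame_matrix (triple_frame v u w)) = prod ?c UNIV * of_int (sign ?p) *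
      det (frame_matrix (triple_frame u v w))"
  proof (rule det_signed_permute_rows)
    show "?p permutes UNIV"
      by (intro permutes_compose permutes_swap_id) auto
    have "\<forall>i. frame_matrix (triple_frame v u w) $ i = ?c i *\<^sub>R frame_matrix (triple_frame u v w) $ ?p i"
      unfolding forall_7
      by (simp add: Transposition.transpose_def cross7_skew [of v u] cross7_linear)
    then show "frame_matrix (triple_frame v u w) $ i = ?c i *\<^sub>R frame_matrix (triple_frame u v w) $ ?p i" for i
      by blast
  qed
  moreover have "prod ?c UNIV = 1" unfolding UNIV_7 by simp
  moreover have "sign ?p = 1" by (simp add: sign_transpose_compose)
  ultimately show ?thesis by (simp add: triple_det_def)
qed

lemma triple_det_swap23:
  assumes "orthogonal_triple u v w"
  shows "triple_det u w v = triple_det u v w"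
proof -
  let ?p = "Transposition.transpose 2 4 \<circ> Transposition.transpose 3 5 :: 7 \<Rightarrow> 7"
  let ?c = "\<lambda>i::7. if i = 6 \<or> i = 7 then - 1 else 1 :: real"
  \<comment> \<open>The seventh row is the only one that needs more than skew-symmetry:
    anticommutation exchanges \<open>v\<close> and \<open>w\<close> at the cost of a sign.\<close>
  have "cross7 (cross7 u w) v = cross7 v (cross7 w u)"
    by (simp add: cross7_skew [of _ v] cross7_skew [of w u] cross7_linear)
  also have "\<dots> = - cross7 w (cross7 v u)"
    using assms by (intro cross7_anticommute) (auto simp: orthogonal_triple_def inner_commute)
  also have "\<dots> = - cross7 (cross7 u v) w"
    by (simp add: cross7_skew [of _ w] cross7_skew [of v u] cross7_linear)
  finally have 7: "cross7 (cross7 u w) v = - cross7 (cross7 u v) w" .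
  have "det (frame_matrix (triple_frame u w v)) = prod ?c UNIV * of_int (sign ?p) *
      det (frame_matrix (triple_frame u v w))"
  proof (rule det_signed_permute_rows)
    show "?p permutes UNIV"
      by (intro permutes_compose permutes_swap_id) auto
    have "\<forall>i. frame_matrix (triple_frame u w v) $ i = ?c i *\<^sub>R frame_matrix (triple_frame u v w) $ ?p i"
      unfolding forall_7
      by (simp add: Transposition.transpose_def 7 cross7_skew [of w v])
    then show "frame_matrix (triple_frame u w v) $ i = ?c i *\<^sub>R frame_matrix (triple_frame u v w) $ ?p i" for i
      by blast
  qed
  moreover have "prod ?c UNIV = 1" unfolding UNIV_7 by simp
  moreover have "sign ?p = 1" by (simp add: sign_transpose_compose)
  ultimately show ?thesis by (simp add: triple_det_def)
qed

text \<open>Each frame vector is constant or linear in the third vector. The swaps bring the other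
  two vectors into this position.\<close>

lemma continuous_on_triple_det:
  assumes "continuous_on S w"
  shows "continuous_on S (\<lambda>t. triple_det u v (w t))"
proof -
  have lin: "linear (cross7 a)" for a
    using bilinear_cross7 by (simp add: bilinear_def)
  have c: "continuous_on S (\<lambda>t. cross7 a (w t))" for a
    using continuous_on_compose2 [OF linear_continuous_on [OF lin [of a, unfolded linear_conv_bounded_linear]] assms, of UNIV] by simp
  have "\<forall>i. continuous_on S (\<lambda>t. frame_matrix (triple_frame u v (w t)) $ i)"
    unfolding forall_7 by (simp add: c assms continuous_on_const)
  then have "continuous_on S (\<lambda>t. frame_matrix (triple_frame u v (w t)) $ i $ j)" for i j
    using continuous_on_component [of S "\<lambda>t. frame_matrix (triple_frame u v (w t)) $ i"] by blast
  then show ?thesis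
    unfolding triple_det_def det_def
    by (intro continuous_on_sum continuous_on_mult continuous_on_const continuous_on_prod)
qed

text \<open>The orthogonality conditions are linear in \<open>w\<close>, and the angle condition
  keeps the segment from \<open>w\<close> to \<open>w'\<close> away from 0. A sign change would give
  a zero of the determinant on an orthogonal triple.\<close>

lemma triple_det_pos_segment:
  assumes t: "orthogonal_triple u v w" "orthogonal_triple u v w'" and "w \<bullet> w' \<ge> 0"
    and pos: "triple_det u v w > 0"
  shows "triple_det u v w' > 0"
proof (rule ccontr)
  let ?x = "\<lambda>t::real. (1 - t) *\<^sub>R w + t *\<^sub>R w'"
  assume "\<not> triple_det u v w' > 0"
  moreover have "continuous_on {0..1} (\<lambda>t. triple_det u v (?x t))"
    by (intro continuous_on_triple_det continuous_intros)
  ultimately obtain s where s: "0 \<le> s" "s \<le> 1" "triple_det u v (?x s) = 0"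
    using IVT2' [of "\<lambda>t. triple_det u v (?x t)" 1 0 0] pos by auto
  have "?x s \<bullet> ?x s = (1 - s)^2 * (w \<bullet> w) + s^2 * (w' \<bullet> w') + 2 * ((1 - s) * s * (w \<bullet> w'))"
    by (simp add: inner_add_left inner_add_right inner_commute [of w' w] power2_eq_square) (simp add: algebra_simps)
  moreover have "(1 - s) * s * (w \<bullet> w') \<ge> 0" using s assms(3) by simp
  moreover have "(1 - s)^2 * (w \<bullet> w) + s^2 * (w' \<bullet> w') > 0"
  proof (cases "s = 0")
    case True
    then show ?thesis using t by (simp add: orthogonal_triple_def)
  next
    case False
    then have "s^2 * (w' \<bullet> w') > 0" using t by (simp add: orthogonal_triple_def)
    then show ?thesis by (simp add: add_nonneg_pos)
  qed
  ultimately have "?x s \<noteq> 0" by auto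
  then have "orthogonal_triple u v (?x s)"
    using t by (simp add: orthogonal_triple_def inner_add_right)
  then show False using triple_det_nz s(3) by blast
qed

text \<open>If \<open>w\<close> and \<open>w'\<close> form an obtuse angle, the segment may meet 0.
  The detour runs through \<open>cross7 u w\<close> or its negative: both are orthogonal to
  \<open>w\<close>, and one of them has nonnegative inner product with \<open>w'\<close>.\<close>

lemma triple_det_pos_third:
  assumes t: "orthogonal_triple u v w" "orthogonal_triple u v w'"
    and pos: "triple_det u v w > 0"
  shows "triple_det u v w' > 0"
proof -
  have *: "orthogonal_triple u v (cross7 u w)"
    using triple_frame_inner [OF t(1), of 1 5] triple_frame_inner [OF t(1), of 2 5]
      triple_frame_inner [OF t(1), of 3 5] triple_frame_nz [OF t(1), of 5] t(1)
    by (simp add: orthogonal_triple_def)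
  then have **: "orthogonal_triple u v (- cross7 u w)"
    by (simp add: orthogonal_triple_def)
  define x where "x = (if cross7 u w \<bullet> w' \<ge> 0 then cross7 u w else - cross7 u w)"
  have "orthogonal_triple u v x" "w \<bullet> x \<ge> 0" "x \<bullet> w' \<ge> 0"
    using * ** by (auto simp: x_def)
  then show ?thesis using triple_det_pos_segment t pos by blast
qed

lemma orthogonal_vector_exists:
  fixes S :: "(real^7) set"
  assumes "finite S" "card S < 7"
  obtains x where "x \<noteq> 0" "\<And>y. y \<in> S \<Longrightarrow> y \<bullet> x = 0"
proof -
  have "dim S < DIM(real^7)"
    using dim_le_card' [OF assms(1)] assms(2) by simp
  then show thesis
    by (metis orthogonal_to_subspace_exists orthogonal_def inner_commute span_base that)
qed

text \<open>Five vectors leave room for an \<open>x\<close> that completes both \<open>u, v\<close>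
  and \<open>u, v'\<close> to a triple. With \<open>x\<close> swapped into second place,
  \<open>v\<close> moves to \<open>v'\<close> as a third vector.\<close>

lemma triple_det_pos_second:
  assumes t: "orthogonal_triple u v w" "orthogonal_triple u v' w'"
    and pos: "triple_det u v w > 0"
  shows "triple_det u v' w' > 0"
proof -
  have "card (set [u, v, v', cross7 u v, cross7 u v']) < 7"
    by (rule le_less_trans [OF card_length]) simp
  then obtain x where x: "x \<noteq> 0" "\<And>y. y \<in> set [u, v, v', cross7 u v, cross7 u v'] \<Longrightarrow> y \<bullet> x = 0"
    using orthogonal_vector_exists by blast
  have o: "orthogonal_triple u v x" "orthogonal_triple u v' x"
    using t x by (auto simp: orthogonal_triple_def)
  then have "triple_det u v x > 0" using triple_det_pos_third t pos by blast
  then have "triple_det u x v > 0" using triple_det_swap23 o by simp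
  then have "triple_det u x v' > 0"
    using triple_det_pos_third orthogonal_triple_swap23 o by blast
  then have "triple_det u v' x > 0" using triple_det_swap23 o by simp
  then show ?thesis using triple_det_pos_third t o by blast
qed

text \<open>An \<open>x\<close> orthogonal to \<open>u\<close> and \<open>u'\<close> is made second
  and then swapped into first place, so that \<open>u\<close> moves to \<open>u'\<close> as a second
  vector.\<close>

lemma triple_det_pos_transfer:
  assumes t: "orthogonal_triple u v w" "orthogonal_triple u' v' w'"
    and pos: "triple_det u v w > 0"
  shows "triple_det u' v' w' > 0"
proof -
  have "card (set [u, u']) < 7"
    by (rule le_less_trans [OF card_length]) simp
  then obtain x where x: "x \<noteq> 0" "\<And>y. y \<in> set [u, u'] \<Longrightarrow> y \<bullet> x = 0"
    using orthogonal_vector_exists by blast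
  have ex: "\<exists>y. orthogonal_triple a x y" if "a \<noteq> 0" "a \<bullet> x = 0" for a
  proof -
    have "card (set [a, x, cross7 a x]) < 7"
      by (rule le_less_trans [OF card_length]) simp
    then obtain y where "y \<noteq> 0" "\<And>z. z \<in> set [a, x, cross7 a x] \<Longrightarrow> z \<bullet> y = 0"
      using orthogonal_vector_exists by blast
    then show ?thesis using that x(1) by (auto simp: orthogonal_triple_def)
  qed
  obtain y where y: "orthogonal_triple u x y"
    using ex [of u] x t by (auto simp: orthogonal_triple_def)
  obtain y' where y': "orthogonal_triple u' x y'"
    using ex [of u'] x t by (auto simp: orthogonal_triple_def)
  have "triple_det u x y > 0" using triple_det_pos_second t y pos by blast
  then have "triple_det x u y > 0" by (simp add: triple_det_swap12)
  then have "triple_det x u' y' > 0"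
    using triple_det_pos_second orthogonal_triple_swap12 y y' by blast
  then have "triple_det u' x y' > 0" by (simp add: triple_det_swap12)
  then show ?thesis using triple_det_pos_second y' t by blast
qed

lemma triple_det_pos:
  assumes "orthogonal_triple u v w"
  shows "triple_det u v w > 0"
proof (rule triple_det_pos_transfer [OF _ assms])
  let ?a = "axis 1 1 :: real^7" and ?b = "axis 2 1 :: real^7" and ?c = "axis 4 1 :: real^7"
  have c: "cross7 ?a ?b = axis 3 1" "cross7 ?a ?c = axis 5 1" "cross7 ?b ?c = axis 6 1"
    "cross7 (axis 3 1) ?c = axis 7 1"
    by (simp_all add: vec_eq_iff forall_7 cross7_nth axis_def)
  show "orthogonal_triple ?a ?b ?c"
    by (simp add: orthogonal_triple_def c inner_axis_axis axis_eq_0_iff)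
  \<comment> \<open>The products in \<open>c\<close> show that this frame is the standard basis in
    its usual order.\<close>
  have "\<forall>i. frame_matrix (triple_frame ?a ?b ?c) $ i = mat 1 $ i"
    unfolding forall_7 by (simp add: c) (simp add: vec_eq_iff mat_def axis_def)
  then have "frame_matrix (triple_frame ?a ?b ?c) = mat 1" by (simp add: vec_eq_iff)
  then show "triple_det ?a ?b ?c > 0" by (simp add: triple_det_def)
qed

subsection \<open>Eigenvectors\<close>

text \<open>A maximizer of the quadratic form on the unit sphere of \<open>V\<close> is an
  eigenvector, because its residual \<open>r\<close> would otherwise be a direction of increase of
  the Rayleigh quotient.\<close>

lemma symmetric_max_eigenvector:
  fixes T :: "'a::euclidean_space \<Rightarrow> 'a"
  assumes T: "linear T" and V: "subspace V" and inv: "\<And>v. v \<in> V \<Longrightarrow> T v \<in> V"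
    and sym: "\<And>v w. v \<in> V \<Longrightarrow> w \<in> V \<Longrightarrow> T v \<bullet> w = v \<bullet> T w"
    and nz: "x \<in> V" "x \<noteq> 0"
  obtains v c where "v \<in> V" "norm v = 1" "T v = c *\<^sub>R v" "\<And>w. w \<in> V \<Longrightarrow> T w \<bullet> w \<le> c * (w \<bullet> w)"
proof -
  have "compact (V \<inter> sphere 0 1)"
    by (simp add: V closed_Int_compact closed_subspace)
  moreover have "x /\<^sub>R norm x \<in> V \<inter> sphere 0 1"
    using nz V by (simp add: subspace_scale)
  then have "V \<inter> sphere 0 1 \<noteq> {}" by blast
  moreover have "continuous_on (V \<inter> sphere 0 1) (\<lambda>v. T v \<bullet> v)"
    by (intro continuous_intros linear_continuous_on) (use T in \<open>simp add: linear_conv_bounded_linear\<close>)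
  ultimately obtain v where sup: "v \<in> V \<inter> sphere 0 1" "\<forall>w\<in>V \<inter> sphere 0 1. T w \<bullet> w \<le> T v \<bullet> v"
    using continuous_attains_sup by blast
  then have v: "v \<in> V" "norm v = 1" by auto
  have max: "T w \<bullet> w \<le> T v \<bullet> v" if "w \<in> V" "norm w = 1" for w
    using sup(2) that by auto
  define c where "c = T v \<bullet> v"
  have le: "T w \<bullet> w \<le> c * (w \<bullet> w)" if "w \<in> V" for w
  proof (cases "w = 0")
    case False
    have "T (w /\<^sub>R norm w) \<bullet> (w /\<^sub>R norm w) \<le> c"
      unfolding c_def using that False V by (intro max) (simp_all add: subspace_scale)
    then have "(T w \<bullet> w) / (norm w)^2 \<le> c"
      by (simp add: linear_scale [OF T] power2_eq_square divide_inverse mult.commute mult.left_commute)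
    then show ?thesis
      using False by (simp add: divide_le_eq dot_square_norm)
  qed (simp add: linear_0 [OF T])
  define r where "r = T v - c *\<^sub>R v"
  have rV: "r \<in> V"
    unfolding r_def using V v inv by (simp add: subspace_diff subspace_scale)
  have Tvr: "T v \<bullet> r = r \<bullet> r + c * (v \<bullet> r)"
    using inner_diff_left [of "T v" "c *\<^sub>R v" r] by (simp flip: r_def)
  have vv: "v \<bullet> v = 1" using v by (simp add: dot_square_norm)
  \<comment> \<open>The bound \<open>le\<close> at \<open>v + t *\<^sub>R r\<close>: the terms of
    order 0 cancel, leaving a linear term against a quadratic one.\<close>
  have quad: "2 * t * (r \<bullet> r) \<le> t^2 * (c * (r \<bullet> r) - T r \<bullet> r)" for t
  proof -
    have "T (v + t *\<^sub>R r) \<bullet> (v + t *\<^sub>R r) \<le> c * ((v + t *\<^sub>R r) \<bullet> (v + t *\<^sub>R r))"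
      using V v rV by (intro le) (simp add: subspace_add subspace_scale)
    moreover have "T r \<bullet> v = T v \<bullet> r"
      using sym [OF rV v(1)] by (simp add: inner_commute)
    ultimately show ?thesis
      by (simp add: linear_add [OF T] linear_scale [OF T] inner_add_left inner_add_right
          vv c_def [symmetric] inner_commute [of r v] Tvr)
        (simp add: algebra_simps power2_eq_square)
  qed
  have "r \<bullet> r = 0"
  proof (rule ccontr)
    assume "r \<bullet> r \<noteq> 0"
    then have b: "r \<bullet> r > 0" by (simp add: inner_gt_zero_iff)
    define d where "d = c * (r \<bullet> r) - T r \<bullet> r"
    \<comment> \<open>Small enough for the quadratic term to lose: \<open>t * d\<close> is at most
      \<open>r \<bullet> r\<close>. The summand 1 keeps the denominator positive.\<close>
    define t where "t = (r \<bullet> r) / (\<bar>d\<bar> + 1)"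
    have t: "t > 0" using b by (simp add: t_def add_nonneg_pos)
    have "t * (2 * (r \<bullet> r)) \<le> t * (t * d)"
      using quad [of t] by (simp add: d_def power2_eq_square mult.assoc mult.left_commute)
    then have "2 * (r \<bullet> r) \<le> t * d" using t by simp
    also have "\<dots> \<le> t * (\<bar>d\<bar> + 1)" using t by (intro mult_left_mono) auto
    also have "\<dots> = r \<bullet> r" by (simp add: t_def)
    finally show False using b by simp
  qed
  then have "T v = c *\<^sub>R v" by (simp add: r_def)
  then show thesis using that v le by blast
qed

text \<open>The determinant of the transpose, that is of minus the matrix, equals minus the
  determinant in odd dimension, so it vanishes.\<close>

lemma skew_odd_dim_kernel:
  fixes X :: "real^'n \<Rightarrow> real^'n"
  assumes X: "linear X" and skew: "\<And>u v. X u \<bullet> v = - (X v \<bullet> u)" and odd: "odd CARD('n)"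
  obtains n where "norm n = 1" "X n = 0"
proof -
  have "matrix ((*\<^sub>R) (- 1)) ** matrix X = matrix ((*\<^sub>R) (- 1) \<circ> X)"
    by (rule matrix_compose [OF X, symmetric]) (simp add: linear_scale_self)
  also have "\<dots> = transpose (matrix X)"
    using skew by (simp add: vec_eq_iff matrix_def transpose_def) (metis inner_axis inner_real_def mult.right_neutral)
  finally have "det (matrix X) = (- 1) ^ CARD('n) * det (matrix X)"
    by (metis det_mul det_matrix_scaleR det_transpose)
  then have "det (matrix X) = 0" using odd by simp
  then have "\<not> inj X" using det_nz_iff_inj [OF X] by simp
  then obtain x where x: "X x = 0" "x \<noteq> 0" using linear_injective_0 [OF X] by auto
  then show thesis
    by (intro that [of "x /\<^sub>R norm x"]) (simp_all add: linear_scale [OF X])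
qed

section \<open>Derivations and their kernel vectors\<close>

lemma g2D:
  assumes "X \<in> g2"
  shows "linear X" "X u \<bullet> v = - (X v \<bullet> u)" "X (cross7 u v) = cross7 (X u) v + cross7 u (X v)"
  using assms unfolding g2_def Lambda2_def by blast+

text \<open>\<open>cross7 n\<close> and \<open>X\<close> are both skew, and they commute by the
  derivation rule with \<open>X n = 0\<close>; hence their composite is symmetric.\<close>

lemma g2_kernel_symmetric:
  assumes X: "X \<in> g2" and n: "X n = 0"
  shows "cross7 n (X v) \<bullet> w = v \<bullet> cross7 n (X w)"
proof -
  have "cross7 n (X v) \<bullet> w = - (X v \<bullet> cross7 n w)"
    using inner_cross7_rotate [of w n "X v"] inner_cross7_rotate [of n "X v" w] cross7_skew [of w n]
    by (simp add: inner_commute)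
  also have "\<dots> = v \<bullet> X (cross7 n w)"
    using g2D(2) [OF X, of v "cross7 n w"] by (simp add: inner_commute)
  finally show ?thesis by (simp add: g2D(3) [OF X] n cross7_linear)
qed

text \<open>By skewness \<open>X v\<close> is orthogonal to \<open>n\<close>, where
  \<open>cross7 n\<close> squares to -1; so \<open>X v\<close> is recovered from
  \<open>cross7 n (X v)\<close>.\<close>

lemma g2_kernel_eigenvector:
  assumes X: "X \<in> g2" and n: "X n = 0" "norm n = 1" and v: "n \<bullet> v = 0"
    and ev: "cross7 n (X v) = c *\<^sub>R v"
  shows "X v = - c *\<^sub>R cross7 n v"
proof -
  have "n \<bullet> X v = 0" using g2D(2) [OF X, of v n] n by (simp add: inner_commute)
  then have "X v = - cross7 n (cross7 n (X v))"
    using n by (simp add: cross7_cross7_self dot_square_norm)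
  then show ?thesis by (simp add: ev cross7_linear)
qed

lemma g2_linear_cross:
  assumes "X \<in> g2" shows "linear (\<lambda>v. cross7 n (X v))"
  using linear_compose [OF g2D(1) [OF assms], of "cross7 n"] bilinear_cross7
  by (simp add: bilinear_def o_def)

text \<open>The maxima of the quadratic form for \<open>n\<close> and for \<open>- n\<close> bound
  it from above and below. Choosing the sign of \<open>n\<close> with the larger maximum bounds its
  absolute value.\<close>

lemma g2_kernel_extremal:
  assumes X: "X \<in> g2"
  obtains n v c where "norm n = 1" "X n = 0" "norm v = 1" "n \<bullet> v = 0" "cross7 n (X v) = c *\<^sub>R v"
    "c \<ge> 0" "\<And>w. n \<bullet> w = 0 \<Longrightarrow> \<bar>cross7 n (X w) \<bullet> w\<bar> \<le> c * (w \<bullet> w)"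
proof -
  have top: "\<exists>v c. norm v = 1 \<and> n \<bullet> v = 0 \<and> cross7 n (X v) = c *\<^sub>R v \<and>
      (\<forall>w. n \<bullet> w = 0 \<longrightarrow> cross7 n (X w) \<bullet> w \<le> c * (w \<bullet> w))"
    if n: "X n = 0" for n
  proof -
    obtain x where x: "x \<noteq> 0" "orthogonal n x"
      using orthogonal_to_vector_exists [of n] by auto
    show ?thesis
      by (rule symmetric_max_eigenvector [of "\<lambda>v. cross7 n (X v)" "{v. n \<bullet> v = 0}" x])
        (use x in \<open>auto simp: g2_linear_cross [OF X] subspace_hyperplane orthogonal_def
          g2_kernel_symmetric [OF X n]\<close>)
  qed
  obtain n where n: "norm n = 1" "X n = 0"
    using skew_odd_dim_kernel [OF g2D(1,2) [OF X]] by auto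
  have n': "X (- n) = 0" using n by (simp add: linear_neg [OF g2D(1) [OF X]])
  obtain v c where v: "norm v = 1" "n \<bullet> v = 0" "cross7 n (X v) = c *\<^sub>R v"
      "\<And>w. n \<bullet> w = 0 \<Longrightarrow> cross7 n (X w) \<bullet> w \<le> c * (w \<bullet> w)"
    using top [OF n(2)] by blast
  obtain v' c' where v': "norm v' = 1" "n \<bullet> v' = 0" "cross7 (- n) (X v') = c' *\<^sub>R v'"
      "\<And>w. n \<bullet> w = 0 \<Longrightarrow> - (cross7 n (X w) \<bullet> w) \<le> c' * (w \<bullet> w)"
    using top [OF n'] by (auto simp: cross7_linear)
  have vv: "v \<bullet> v = 1" "v' \<bullet> v' = 1" using v v' by (simp_all add: dot_square_norm)
  show thesis
  proof (cases "c' \<le> c")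
    case True
    \<comment> \<open>The bound for \<open>- n\<close>, tested at \<open>v\<close>; together with
      \<open>c' \<le> c\<close> it gives \<open>c \<ge> 0\<close>.\<close>
    have "- c \<le> c'" using v'(4) [OF v(2)] v(3) vv by simp
    moreover have "\<bar>cross7 n (X w) \<bullet> w\<bar> \<le> c * (w \<bullet> w)" if "n \<bullet> w = 0" for w
      using v(4) [OF that] v'(4) [OF that] mult_right_mono [OF True, of "w \<bullet> w"] by simp
    ultimately show thesis using that [OF n v(1-3)] True by simp
  next
    case False
    then have le: "c \<le> c'" by simp
    have "cross7 n (X v') = - c' *\<^sub>R v'" using v'(3) by (simp add: cross7_linear) (metis minus_equation_iff)
    then have "- c' \<le> c" using v(4) [OF v'(2)] vv by simp
    moreover have "\<bar>cross7 (- n) (X w) \<bullet> w\<bar> \<le> c' * (w \<bullet> w)" if "- n \<bullet> w = 0" for w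
      using v(4) [of w] v'(4) [of w] that mult_right_mono [OF le, of "w \<bullet> w"] by (simp add: cross7_linear)
    ultimately show thesis using that [of "- n" v' c'] n n' v' le by simp
  qed
qed

section \<open>Adapted frames and the normal form\<close>

lemma orthonormal_expansion:
  fixes e :: "nat \<Rightarrow> real^7"
  assumes on: "\<And>i j. i \<in> {1..7} \<Longrightarrow> j \<in> {1..7} \<Longrightarrow> e i \<bullet> e j = (if i = j then 1 else 0)"
  shows "v = (\<Sum>i\<in>{1..7}. (v \<bullet> e i) *\<^sub>R e i)"
    and "K \<subseteq> {1..7} \<Longrightarrow> dim (span (e ` K)) = card K"
    and "span (e ` {1..7}) = UNIV"
proof -
  have inj: "inj_on e {1..7}"
    by (rule inj_onI) (metis on zero_neq_one)
  have ind: "independent (e ` {1..7})"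
    using on by (intro pairwise_orthogonal_independent) (fastforce simp: pairwise_def orthogonal_def)+
  show "dim (span (e ` K)) = card K" if "K \<subseteq> {1..7}"
    using that dim_eq_card_independent [OF independent_mono [OF ind image_mono [OF that]]]
    by (simp add: card_image inj_on_subset [OF inj])
  have "dim (e ` {1..7}) = DIM(real^7)"
    using dim_eq_card_independent [OF ind] card_image [OF inj] by simp
  then have sp: "span (e ` {1..7}) = UNIV" using dim_eq_full by blast
  then show "span (e ` {1..7}) = UNIV" .
  define r where "r = v - (\<Sum>i\<in>{1..7}. (v \<bullet> e i) *\<^sub>R e i)"
  have "r \<bullet> e j = 0" if "j \<in> {1..7}" for j
    using that by (simp add: r_def inner_diff_left inner_sum_left on if_distrib sum.delta cong: if_cong)
  then have "orthogonal r y" if "y \<in> e ` {1..7}" for y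
    using that by (auto simp: orthogonal_def)
  then have "orthogonal r r" using orthogonal_to_span [of r "e ` {1..7}" r] sp by auto
  then show "v = (\<Sum>i\<in>{1..7}. (v \<bullet> e i) *\<^sub>R e i)" by (simp add: r_def orthogonal_self)
qed

lemma triple_frame_adapted:
  assumes "orthogonal_triple u v w" "norm u = 1" "norm v = 1" "norm w = 1"
  shows "G2_adapted (triple_frame u v w)"
proof -
  have n: "u \<bullet> u = 1" "v \<bullet> v = 1" "w \<bullet> w = 1" using assms by (simp_all add: dot_square_norm)
  have "\<forall>i\<in>{1,2,3,4,5,6,7}. [1, 1, 1 * 1, 1, 1 * 1, 1 * 1, 1 * 1 * 1] ! (i - 1) = (1::real)"
    by simp
  then have "triple_frame u v w i \<bullet> triple_frame u v w j = (if i = j then 1 else 0)"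
    if "i \<in> {1..7}" "j \<in> {1..7}" for i j
    using triple_frame_inner [OF assms(1) that] that n unfolding atLeastAtMost_1_7 by presburger
  then show ?thesis
    using triple_det_pos [OF assms(1)]
    by (simp add: G2_adapted_def oriented_orthonormal_def triple_det_def)
qed

text \<open>The bound \<open>2 * m \<le> l\<close>, stronger than \<open>m \<le> l\<close>, is what
  makes \<open>l = m\<close> force both to be 0.\<close>

lemma g2_adapted_frame_exists:
  assumes X: "X \<in> g2"
  obtains e l m where "G2_adapted e" "0 \<le> m" "2 * m \<le> l"
    "X (e 1) = - l *\<^sub>R e 2" "X (e 2) = l *\<^sub>R e 1" "X (e 3) = 0" "X (e 4) = (l - m) *\<^sub>R e 7"
    "X (e 5) = - m *\<^sub>R e 6" "X (e 6) = m *\<^sub>R e 5" "X (e 7) = - (l - m) *\<^sub>R e 4"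
proof -
  note lin = g2D(1) [OF X] and deriv = g2D(3) [OF X]
  obtain n a l where n: "norm n = 1" "X n = 0" and a: "norm a = 1" "n \<bullet> a = 0"
    and Sa: "cross7 n (X a) = l *\<^sub>R a" and l: "l \<ge> 0"
    and bound: "\<And>w. n \<bullet> w = 0 \<Longrightarrow> \<bar>cross7 n (X w) \<bullet> w\<bar> \<le> l * (w \<bullet> w)"
    using g2_kernel_extremal [OF X] by blast
  note sym = g2_kernel_symmetric [OF X n(2)]
  \<comment> \<open>With this order \<open>cross7 a b = n\<close>, so the kernel vector becomes the
    third frame vector.\<close>
  define b where "b = cross7 n a"
  have nn: "n \<bullet> n = 1" "a \<bullet> a = 1" using n a by (simp_all add: dot_square_norm)
  have an: "a \<bullet> n = 0" using a by (simp add: inner_commute)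
  have bb: "b \<bullet> b = 1" using nn an by (simp add: b_def inner_cross7_cross7 a)
  have nb: "cross7 n b = - a" using nn by (simp add: b_def cross7_cross7_self a)
  have ab: "cross7 a b = n"
    using nn an by (simp add: b_def cross7_skew [of n a] cross7_linear cross7_cross7_self)
  have ba: "cross7 b a = - n" using ab by (simp add: cross7_skew [of b a])
  have Xa: "X a = - l *\<^sub>R b"
    using g2_kernel_eigenvector [OF X n(2,1) a(2) Sa] by (simp add: b_def)
  have Xb: "X b = l *\<^sub>R a"
    by (simp add: b_def deriv n Xa cross7_linear) (simp add: cross7_linear nb flip: b_def)
  have Sb: "cross7 n (X b) = l *\<^sub>R b" unfolding Xb by (simp add: cross7_linear b_def)
  define W where "W = {v. n \<bullet> v = 0 \<and> a \<bullet> v = 0 \<and> b \<bullet> v = 0}"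
  have "card (set [n, a, b]) < 7" by (rule le_less_trans [OF card_length]) simp
  then obtain x where x: "x \<noteq> 0" "\<And>y. y \<in> set [n, a, b] \<Longrightarrow> y \<bullet> x = 0"
    using orthogonal_vector_exists by blast
  have W: "subspace W" unfolding W_def subspace_def by (auto simp: inner_add_right)
  \<comment> \<open>A symmetric operator with eigenvectors \<open>a\<close> and \<open>b\<close>
    preserves their orthogonal complement, and its values are orthogonal to
    \<open>n\<close>.\<close>
  have inv: "- cross7 n (X v) \<in> W" if "v \<in> W" for v
    using that sym [of a v] sym [of b v] by (simp add: W_def Sa Sb)
  have xW: "x \<in> W" using x(2) by (simp add: W_def)
  \<comment> \<open>Maximizing the negated operator on \<open>W\<close> yields its least eigenvalue
    \<open>- k\<close>.\<close>
  have lin': "linear (\<lambda>v. - cross7 n (X v))" by (intro linear_compose_neg g2_linear_cross [OF X])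
  have sym': "- cross7 n (X v) \<bullet> w = v \<bullet> - cross7 n (X w)" for v w by (simp add: sym)
  obtain c k where c: "c \<in> W" "norm c = 1" and Sc: "- cross7 n (X c) = k *\<^sub>R c"
    and maxk: "\<And>w. w \<in> W \<Longrightarrow> - cross7 n (X w) \<bullet> w \<le> k * (w \<bullet> w)"
    using symmetric_max_eigenvector [OF lin' W inv sym' xW x(1)] by blast
  have cc: "c \<bullet> c = 1" using c by (simp add: dot_square_norm)
  have oc: "n \<bullet> c = 0" "a \<bullet> c = 0" "b \<bullet> c = 0" "c \<bullet> n = 0" "c \<bullet> a = 0" "c \<bullet> b = 0"
    using c by (simp_all add: W_def inner_commute)
  have oab: "a \<bullet> b = 0" "b \<bullet> n = 0" "n \<bullet> b = 0" by (simp_all add: b_def)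
  have t: "orthogonal_triple a b c"
    using nn bb cc oc oab by (auto simp: orthogonal_triple_def ab)
  have Xc: "X c = k *\<^sub>R cross7 n c"
    using g2_kernel_eigenvector [OF X n(2,1) oc(1), of "- k"] Sc by (simp add: minus_equation_iff)
  have ncc: "cross7 n (cross7 n c) = - c" using oc nn by (simp add: cross7_cross7_self)
  \<comment> \<open>Extremality of \<open>l\<close> bounds the eigenvalue \<open>- k\<close> in
    absolute value; this becomes \<open>0 \<le> m\<close>.\<close>
  have kl: "k \<le> l" using bound [OF oc(1)] Sc cc
    by (metis abs_le_D2 inner_minus_left inner_scaleR_left mult.right_neutral)
  have anc: "cross7 a (cross7 n c) = cross7 b c"
  proof -
    have "cross7 a (cross7 n c) = - cross7 a (cross7 c n)"
      by (simp add: cross7_skew [of n c] cross7_linear)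
    also have "\<dots> = cross7 c (cross7 a n)"
      using cross7_anticommute [of a c n] oc an by simp
    finally show ?thesis by (simp add: b_def cross7_skew [of a n] cross7_skew [of c] cross7_linear)
  qed
  have bnc: "cross7 b (cross7 n c) = - cross7 a c"
  proof -
    have "cross7 b (cross7 n c) = - cross7 b (cross7 c n)"
      by (simp add: cross7_skew [of n c] cross7_linear)
    also have "\<dots> = cross7 c (cross7 b n)"
      using cross7_anticommute [of b c n] oc oab by simp
    also have "cross7 b n = a" using nb by (simp add: cross7_skew [of b n])
    finally show ?thesis by (simp add: cross7_skew [of c a])
  qed
  \<comment> \<open>By the derivation rule \<open>cross7 a c\<close> goes to \<open>k - l\<close>
    times \<open>cross7 b c\<close>, which fixes \<open>m\<close>; the entry for \<open>c\<close> is
    then \<open>k = l - m\<close>.\<close>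
  define m where "m = l - k"
  have X5: "X (cross7 a c) = - m *\<^sub>R cross7 b c"
    by (simp add: deriv Xa Xc cross7_linear anc m_def algebra_simps)
  have X6: "X (cross7 b c) = m *\<^sub>R cross7 a c"
    by (simp add: deriv Xb Xc cross7_linear bnc m_def algebra_simps)
  have X7: "X (cross7 n c) = - k *\<^sub>R c"
    by (simp add: deriv Xc n cross7_linear ncc)
  have nbc: "cross7 n (cross7 b c) = cross7 a c"
    using cross7_anticommute [of n b c] oc oab bnc by simp
  have e5: "cross7 a c \<in> W"
    using triple_frame_inner [OF t, of 3 5] triple_frame_inner [OF t, of 2 5]
    by (simp add: W_def ab)
  have "cross7 a c \<bullet> cross7 a c = 1"
    using nn cc oc by (simp add: inner_cross7_cross7)
  \<comment> \<open>\<open>cross7 a c\<close> is an eigenvector of the negated operator in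
    \<open>W\<close> with eigenvalue \<open>m\<close>, so maximality of \<open>k\<close> applies;
    this is \<open>2 * m \<le> l\<close>.\<close>
  then have "m \<le> k" using maxk [OF e5] by (simp add: X5 cross7_linear nbc)
  show thesis
  proof (rule that [of "triple_frame a b c" m l])
    show "G2_adapted (triple_frame a b c)"
      using t a c bb by (intro triple_frame_adapted) (simp_all add: norm_eq_1)
    show "0 \<le> m" "2 * m \<le> l" using kl \<open>m \<le> k\<close> by (simp_all add: m_def)
  qed (simp_all add: ab Xa Xb Xc X5 X6 X7 n m_def)
qed

text \<open>\<open>X\<close> permutes the basis lines by the involution \<open>s\<close>, up to
  factors. Skewness gives \<open>c (s i) = - c i\<close>, so \<open>s\<close> preserves
  \<open>J\<close>, and range and kernel split along the basis.\<close>

lemma range_kernel_monomial: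
  fixes e :: "nat \<Rightarrow> real^7" and X :: "real^7 \<Rightarrow> real^7"
  assumes X: "linear X" and skew: "\<And>u v. X u \<bullet> v = - (X v \<bullet> u)"
    and on: "\<And>i j. i \<in> {1..7} \<Longrightarrow> j \<in> {1..7} \<Longrightarrow> e i \<bullet> e j = (if i = j then 1 else 0)"
    and s: "\<And>i. i \<in> {1..7} \<Longrightarrow> s i \<in> {1..7} \<and> s (s i) = i"
    and Xe: "\<And>i. i \<in> {1..7} \<Longrightarrow> X (e i) = c i *\<^sub>R e (s i)"
    and J: "J = {i \<in> {1..7}. c i \<noteq> 0}"
  shows "dim (range X) = card J" "{v. X v = 0} = span (e ` ({1..7} - J))"
proof -
  have ex: "v = (\<Sum>i\<in>{1..7}. (v \<bullet> e i) *\<^sub>R e i)" for v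
    using on by (rule orthonormal_expansion)
  have sub: "J \<subseteq> {1..7}" using J by auto
  have ce: "c (s i) = - c i" if "i \<in> {1..7}" for i
    using skew [of "e i" "e (s i)"] s [OF that] that by (simp add: Xe on)
  have sJ: "s i \<in> J" if "i \<in> J" for i
    using s ce that unfolding J by auto
  have mem: "X (e i) \<in> span (e ` J)" if "i \<in> {1..7}" for i
  proof (cases "i \<in> J")
    case True
    then show ?thesis using Xe [OF that] sJ by (simp add: span_scale span_base)
  next
    case False
    then show ?thesis using Xe [OF that] that by (simp add: J span_zero)
  qed
  have "X v \<in> span (e ` J)" for v
    by (subst ex [of v]) (auto simp: linear_sum [OF X] linear_scale [OF X] intro!: span_sum span_scale mem)
  moreover have "e j \<in> range X" if "j \<in> J" for j
  proof -
    have "X (e (s j) /\<^sub>R c (s j)) = e j"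
      using sJ [OF that] s that by (simp add: J linear_scale [OF X] Xe)
    then show ?thesis by (metis rangeI)
  qed
  moreover have "subspace (range X)" using linear_subspace_image [OF X subspace_UNIV] .
  ultimately have "range X = span (e ` J)"
    by (intro subset_antisym span_minimal) auto
  then show "dim (range X) = card J" using orthonormal_expansion(2) [OF on sub] by simp
  show "{v. X v = 0} = span (e ` ({1..7} - J))"
  proof (intro subset_antisym span_minimal)
    show "e ` ({1..7} - J) \<subseteq> {v. X v = 0}" using Xe by (auto simp: J)
    show "subspace {v. X v = 0}" by (rule linear_subspace_kernel [OF X])
    show "{v. X v = 0} \<subseteq> span (e ` ({1..7} - J))"
    proof
      fix v assume "v \<in> {v. X v = 0}"
      then have v: "X v = 0" by simp
      \<comment> \<open>Skewness moves \<open>X\<close> from \<open>v\<close> to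
        \<open>e (s j)\<close>, whose image is a nonzero multiple of \<open>e j\<close>.\<close>
      have "v \<bullet> e j = 0" if "j \<in> J" for j
        using skew [of v "e (s j)"] v sJ [OF that] s [of j] that
        by (simp add: J Xe inner_commute)
      then have "(v \<bullet> e i) *\<^sub>R e i \<in> span (e ` ({1..7} - J))" if "i \<in> {1..7}" for i
        using that by (cases "i \<in> J") (simp_all add: span_scale span_base span_zero)
      then have "(\<Sum>i\<in>{1..7}. (v \<bullet> e i) *\<^sub>R e i) \<in> span (e ` ({1..7} - J))"
        by (rule span_sum)
      then show "v \<in> span (e ` ({1..7} - J))" by (simp only: ex [of v, symmetric])
    qed
  qed
qed

theorem theorem3p5:
  fixes X :: "real^7 \<Rightarrow> real^7"
  assumes "X \<in> g2"
  shows "\<exists>e :: nat \<Rightarrow> real^7. \<exists>l m :: real.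
           G2_adapted e \<and> l \<ge> m \<and> m \<ge> 0
         \<and> (\<forall>i\<in>{1..7}. \<forall>j\<in>{1..7}. X (e i) \<bullet> e j = normal_form l m i j)
         \<and> (l = m \<or> (l > 0 \<and> m = 0) \<or> (l > m \<and> m > 0))
         \<and> (l = m \<longrightarrow> l = 0 \<and> m = 0 \<and> X = (\<lambda>v. 0))
         \<and> (l > 0 \<and> m = 0 \<longrightarrow>
              dim (range X) = 4 \<and> {v. X v = 0} = span {e 3, e 5, e 6}
              \<and> associative (span {e 3, e 5, e 6}))
         \<and> (l > m \<and> m > 0 \<longrightarrow>
              dim (range X) = 6 \<and> {v. X v = 0} = span {e 3})"
proof -
  obtain e l m where e: "G2_adapted e" and lm: "0 \<le> m" "2 * m \<le> l"
    and Xe: "X (e 1) = - l *\<^sub>R e 2" "X (e 2) = l *\<^sub>R e 1" "X (e 3) = 0" "X (e 4) = (l - m) *\<^sub>R e 7"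
      "X (e 5) = - m *\<^sub>R e 6" "X (e 6) = m *\<^sub>R e 5" "X (e 7) = - (l - m) *\<^sub>R e 4"
    using g2_adapted_frame_exists [OF assms] by blast
  note Xe' = Xe [unfolded One_nat_def]
  note lin = g2D(1) [OF assms] and skew = g2D(2) [OF assms] and deriv = g2D(3) [OF assms]
  have on: "e i \<bullet> e j = (if i = j then 1 else 0)" if "i \<in> {1..7}" "j \<in> {1..7}" for i j
    using e that unfolding G2_adapted_def oriented_orthonormal_def by blast
  have nf: "\<forall>i\<in>{1..7}. \<forall>j\<in>{1..7}. X (e i) \<bullet> e j = normal_form l m i j"
    unfolding atLeastAtMost_1_7 by (simp add: Xe' on normal_form_def)
  \<comment> \<open>The leading 0 in both lists fills the position 0, so that indices start at 1.
    The pairs are 1-2, 4-7 and 5-6; 3 is fixed.\<close>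
  define s where "s = (!) [0, 2, 1, 3, 7, 6, 5, 4 :: nat]"
  define c where "c = (!) [0, - l, l, 0, l - m, - m, m, - (l - m)]"
  have "\<forall>i\<in>{1..7}. s i \<in> {1..7} \<and> s (s i) = i"
    unfolding atLeastAtMost_1_7 by (simp add: s_def)
  moreover have "\<forall>i\<in>{1..7}. X (e i) = c i *\<^sub>R e (s i)"
    unfolding atLeastAtMost_1_7 by (simp add: s_def c_def Xe')
  ultimately have rk: "dim (range X) = card J \<and> {v. X v = 0} = span (e ` K)"
    if "J = {i \<in> {1..7}. c i \<noteq> 0}" "K = {1..7} - J" for J K
    using range_kernel_monomial [OF lin skew on, of s c J] that by blast
  have set_Collect: "{i \<in> {1..7::nat}. P i} = set (filter P [1,2,3,4,5,6,7])" for P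
    unfolding atLeastAtMost_1_7 by auto
  have zero: "X = (\<lambda>v. 0)" if "l = 0" "m = 0"
  proof -
    have "{v. X v = 0} = span (e ` {1..7})"
      using rk [of "{}" "{1..7}"] that unfolding set_Collect by (simp add: c_def)
    moreover have "span (e ` {1..7}) = UNIV"
      using on by (rule orthonormal_expansion)
    ultimately show ?thesis by blast
  qed
  have two: "dim (range X) = 4 \<and> {v. X v = 0} = span {e 3, e 5, e 6} \<and> associative (span {e 3, e 5, e 6})"
    if "l > 0" "m = 0"
  proof -
    have "{1,2,4,7} = {i \<in> {1..7}. c i \<noteq> 0}" "{3,5,6} = {1..7} - {1,2,4,7::nat}"
      using that unfolding set_Collect by (simp add: c_def, force)
    from rk [OF this] have r: "dim (range X) = 4" "{v. X v = 0} = span {e 3, e 5, e 6}"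
      by simp_all
    have "dim (span (e ` {3,5,6})) = card {3,5,6::nat}"
      by (rule orthonormal_expansion(2) [OF on]) auto
    \<comment> \<open>Closure under the product holds because the span is the kernel of a
      derivation.\<close>
    then have "associative (span {e 3, e 5, e 6})"
      unfolding associative_def
      by (auto simp: deriv cross7_linear linear_subspace_kernel [OF lin] simp flip: r(2))
    then show ?thesis using r by simp
  qed
  have three: "dim (range X) = 6 \<and> {v. X v = 0} = span {e 3}" if "l > m" "m > 0"
  proof -
    have "{1,2,4,5,6,7} = {i \<in> {1..7}. c i \<noteq> 0}" "{3} = {1..7} - {1,2,4,5,6,7::nat}"
      using that unfolding set_Collect by (simp add: c_def, force)
    from rk [OF this] show ?thesis by simp
  qed
  \<comment> \<open>From \<open>0 \<le> m\<close> and \<open>2 * m \<le> l\<close>, either both are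
    0 or \<open>l > m\<close>; the latter splits according to whether \<open>m\<close> is 0.\<close>
  show ?thesis
    using e nf zero two three lm by (intro exI [of _ e] exI [of _ l] exI [of _ m]) auto
qed

end
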